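(* For every function $f:\mathbb{N}\rightarrow\mathbb{N}$ there is a digraph $D$ with $|V(D)|=2^{\aleph_0}$ and uncountable dichromatic number such that for every $n\in\mathbb{N}$, every subdigraph of $D$ with dichromatic number $n+2$ has at least $f(n)$ vertices.
   Context: A digraph $D$ consists of a vertex set $V(D)$ and a set of ordered pairs $uv$ of vertices with $u\neq v$ (no loops). A directed cycle of length $n\geq 2$ is a digraph of the form $\{v_0v_1,v_1v_2,\dots,v_{n-1}v_0\}$ with the $v_i$ pairwise distinct. A colouring of $V(D)$ is chromatic if no directed cycle of $D$ is monochromatic. The dichromatic number $\chi(D)$ is the smallest cardinal $\kappa$ such that $D$ admits a chromatic colouring with $\kappa$ colours. A digraph is $k$-dichromatic if its dichromatic number is $k$; "uncountably dichromatic" means the dichromatic number is uncountable. *)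

theory Defs
  imports "HOL-Library.FuncSet" "Graph_Theory.Graph_Theory"
begin

unbundle cardinal_syntax

text \<open>
  Digraphs are loopfree pair digraphs of arbitrary cardinality (\<^locale>\<open>pair_loopfree_digraph\<close>;
  the locale \<^locale>\<open>digraph\<close> also requires finiteness). In \<^const>\<open>pre_digraph.cycle\<close> a loop
  is a cycle of length one, hence the explicit lower bound on the length.
\<close>

definition directed_cycle :: "'a pair_pre_digraph \<Rightarrow> ('a \<times> 'a) awalk \<Rightarrow> bool" where
  "directed_cycle D p \<longleftrightarrow> pre_digraph.cycle (with_proj D) p \<and> 2 \<le> length p"

definition monochromatic :: "('a \<Rightarrow> 'k) \<Rightarrow> ('a \<times> 'a) awalk \<Rightarrow> bool" where
  "monochromatic c p \<longleftrightarrow> (\<exists>k. \<forall>e\<in>set p. c (fst e) = k \<and> c (snd e) = k)"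

definition chromatic_colouring :: "'a pair_pre_digraph \<Rightarrow> 'k set \<Rightarrow> ('a \<Rightarrow> 'k) \<Rightarrow> bool" where
  "chromatic_colouring D K c \<longleftrightarrow>
     c \<in> pverts D \<rightarrow> K \<and> (\<forall>p. directed_cycle D p \<longrightarrow> \<not> monochromatic c p)"

definition chromatically_colourable :: "'a pair_pre_digraph \<Rightarrow> 'k rel \<Rightarrow> bool" where
  "chromatically_colourable D \<kappa> \<longleftrightarrow> (\<exists>c. chromatic_colouring D (Field \<kappa>) c)"

text \<open>
  Cardinals are well-orders \<open>\<kappa>\<close> with \<^term>\<open>Card_order \<kappa>\<close>, considered up to \<open>=o\<close>. Colouring the
  vertices by themselves is chromatic, so the least cardinal is attained among
  the cardinals on the vertex type; \<open>dichromatic_number_le\<close> below shows that it is least among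
  the cardinals on any type.
\<close>

definition dichromatic_number :: "'a pair_pre_digraph \<Rightarrow> 'a rel" where
  "dichromatic_number D = (SOME \<kappa>. Card_order \<kappa> \<and> chromatically_colourable D \<kappa> \<and>
     (\<forall>\<kappa>' :: 'a rel. Card_order \<kappa>' \<and> chromatically_colourable D \<kappa>' \<longrightarrow> \<kappa> \<le>o \<kappa>'))"

lemma (in pair_wf_digraph) chromatic_colouring_inj:
  assumes "inj_on c (pverts G)"
  shows "chromatic_colouring G (c ` pverts G) c"
  unfolding chromatic_colouring_def
proof (intro conjI allI impI notI)
  show "c \<in> pverts G \<rightarrow> c ` pverts G" by auto
next
  fix p assume p: "directed_cycle G p" and m: "monochromatic c p"
  from p obtain u where u: "awalk u p u" "distinct (tl (pawalk_verts u p))" "2 \<le> length p"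
    unfolding directed_cycle_def cycle_def by auto
  from u(3) obtain e1 e2 q where pe: "p = e1 # e2 # q"
    by (cases p; cases "tl p") auto
  have cas: "pcas u p u" and sub: "set p \<subseteq> parcs G"
    using u(1) by (auto simp: awalk_def)
  have last: "v \<in> set (pawalk_verts w es)" if "pcas w es v" for w v es
    using that by (induct es arbitrary: w) auto
  have e: "fst e1 = u" "snd e1 = fst e2" "pcas (snd e2) q u" using cas pe by auto
  have "fst e2 \<notin> set (pawalk_verts (snd e2) q)" using u(2) pe by simp
  with last[OF e(3)] have ne: "snd e1 \<noteq> fst e1" using e by auto
  have "e1 \<in> parcs G" using sub pe by simp
  then have "fst e1 \<in> pverts G" "snd e1 \<in> pverts G"
    by (rule arc_fst_in_verts, rule arc_snd_in_verts)
  moreover have "c (fst e1) = c (snd e1)" using m pe unfolding monochromatic_def by auto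
  ultimately show False using assms ne by (auto dest: inj_onD)
qed

lemma (in pair_wf_digraph) dichromatic_number_props:
  shows "Card_order (dichromatic_number G)"
    and "chromatically_colourable G (dichromatic_number G)"
    and "\<And>\<kappa> :: 'a rel. \<lbrakk>Card_order \<kappa>; chromatically_colourable G \<kappa>\<rbrakk> \<Longrightarrow> dichromatic_number G \<le>o \<kappa>"
proof -
  let ?R = "{\<kappa> :: 'a rel. Card_order \<kappa> \<and> chromatically_colourable G \<kappa>}"
  have "chromatic_colouring G (Field |pverts G| ) (\<lambda>v. v)"
    using chromatic_colouring_inj[of "\<lambda>v. v"] by (simp add: Field_card_of)
  then have "|pverts G| \<in> ?R"
    by (auto simp: chromatically_colourable_def card_of_Card_order)
  then have "\<exists>\<kappa>\<in>?R. \<forall>\<kappa>'\<in>?R. \<kappa> \<le>o \<kappa>'"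
    by (intro exists_minim_Card_order) auto
  then have "\<exists>\<kappa> :: 'a rel. Card_order \<kappa> \<and> chromatically_colourable G \<kappa> \<and>
     (\<forall>\<kappa>' :: 'a rel. Card_order \<kappa>' \<and> chromatically_colourable G \<kappa>' \<longrightarrow> \<kappa> \<le>o \<kappa>')"
    by blast
  from someI_ex[OF this, folded dichromatic_number_def]
  show "Card_order (dichromatic_number G)"
    and "chromatically_colourable G (dichromatic_number G)"
    and "\<And>\<kappa> :: 'a rel. \<lbrakk>Card_order \<kappa>; chromatically_colourable G \<kappa>\<rbrakk> \<Longrightarrow> dichromatic_number G \<le>o \<kappa>"
    by auto
qed

lemma (in pair_wf_digraph) dichromatic_number_le:
  fixes \<kappa> :: "'k rel"
  assumes "Card_order \<kappa>" and "chromatically_colourable G \<kappa>"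
  shows "dichromatic_number G \<le>o \<kappa>"
proof -
  from assms(2) obtain c where c: "c \<in> pverts G \<rightarrow> Field \<kappa>"
    and nm: "\<And>p. directed_cycle G p \<Longrightarrow> \<not> monochromatic c p"
    by (auto simp: chromatically_colourable_def chromatic_colouring_def)
  define g where "g = inv_into (pverts G) c"
  have gc: "c (g (c v)) = c v" if "v \<in> pverts G" for v
    using that by (simp add: g_def f_inv_into_f)
  let ?A = "g ` c ` pverts G"
  have "chromatic_colouring G ?A (g \<circ> c)"
    unfolding chromatic_colouring_def
  proof (intro conjI allI impI notI)
    show "g \<circ> c \<in> pverts G \<rightarrow> ?A" by auto
    fix p assume p: "directed_cycle G p" and "monochromatic (g \<circ> c) p"
    then obtain k where k: "\<forall>e\<in>set p. g (c (fst e)) = k \<and> g (c (snd e)) = k"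
      by (auto simp: monochromatic_def)
    have sub: "set p \<subseteq> parcs G"
      using p by (auto simp: directed_cycle_def cycle_def awalk_def)
    have "c (fst e) = c k \<and> c (snd e) = c k" if "e \<in> set p" for e
      using k gc[of "fst e"] gc[of "snd e"] that sub arc_fst_in_verts[of e] arc_snd_in_verts[of e]
      by auto
    then have "monochromatic c p" by (auto simp: monochromatic_def)
    with nm[OF p] show False ..
  qed
  then have "dichromatic_number G \<le>o |?A|"
    by (intro dichromatic_number_props(3))
      (auto simp: chromatically_colourable_def card_of_card_order_on Field_card_of)
  also have "|?A| \<le>o |c ` pverts G|" by (rule card_of_image)
  also have "|c ` pverts G| \<le>o |Field \<kappa>|" using c by (intro card_of_mono1) auto
  also have "|Field \<kappa>| =o \<kappa>" using assms(1) by (rule card_of_Field_ordIso)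
  finally show ?thesis .
qed

end

theory Submission
  imports Defs "HOL-Library.Discrete_Functions"
begin

text \<open>
  The vertices are sequences of natural numbers, and there is an arc from \<open>x\<close> to \<open>y\<close> if at the first
  coordinate \<open>m\<close> at which they differ, \<open>x\<^sub>m \<rightarrow> y\<^sub>m\<close> is an arc of the directed cycle of length \<open>k\<^sub>m\<close>.
  Given a colouring with colours \<open>0, 1, \<dots>\<close> whose classes are all acyclic, choose \<open>x\<^sub>0, x\<^sub>1, \<dots>\<close>
  inductively such that no sequence starting with \<open>x\<^sub>0, \<dots>, x\<^sub>m\<close> has colour \<open>m\<close>; this is possible since
  otherwise colour \<open>m\<close> would contain a copy of the cycle of length \<open>k\<^sub>m\<close>. But then \<open>x\<close> has no colour.
  Conversely, on a strongly connected set of vertices the first coordinate \<open>m\<close> that is not constant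
  runs through the whole cycle of length \<open>k\<^sub>m\<close>. Hence in a subdigraph with few vertices only few
  coordinates, say \<open>l\<close> of them, matter, and recording which of these vanish is a chromatic
  colouring with \<open>2\<^sup>l\<close> colours. It remains to let \<open>k\<close> grow fast enough.
\<close>

section \<open>Acyclic colour classes\<close>

definition monochromatic_arcs :: "'a pair_pre_digraph \<Rightarrow> ('a \<Rightarrow> 'k) \<Rightarrow> 'a rel" where
  "monochromatic_arcs D c = {(u, v) \<in> parcs D. c u = c v}"

lemma monochromatic_arcs_trancl_eq:
  assumes "(u, v) \<in> (monochromatic_arcs D c)\<^sup>+"
  shows "c u = c v"
  using assms by induction (auto simp: monochromatic_arcs_def)

lemma monochromatic_iff_subset_monochromatic_arcs:
  assumes "pcas u p v" and "set p \<subseteq> parcs D"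
  shows "monochromatic c p \<longleftrightarrow> set p \<subseteq> monochromatic_arcs D c"
proof
  assume "monochromatic c p"
  then show "set p \<subseteq> monochromatic_arcs D c"
    using assms(2) by (fastforce simp: monochromatic_def monochromatic_arcs_def)
next
  assume "set p \<subseteq> monochromatic_arcs D c"
  with assms(1) have "\<forall>e\<in>set p. c (fst e) = c u \<and> c (snd e) = c u"
    by (induction p arbitrary: u) (auto simp: monochromatic_arcs_def)
  then show "monochromatic c p" by (auto simp: monochromatic_def)
qed

lemma pcas_imp_trancl:
  assumes "pcas u p v" and "p \<noteq> []"
  shows "(u, v) \<in> (set p)\<^sup>+"
  using assms
proof (induction p arbitrary: u)
  case (Cons e p)
  have "(snd e, v) \<in> (set (e # p))\<^sup>*"
    using Cons by (cases "p = []") (auto intro: trancl_into_rtrancl trancl_mono)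
  moreover have "(u, snd e) \<in> set (e # p)" using Cons.prems by auto
  ultimately show ?case by (rule rtrancl_into_trancl2[rotated])
qed simp

lemma chromatic_colouring_if_acyclic:
  assumes "c \<in> pverts D \<rightarrow> K" and acyclic: "acyclic (monochromatic_arcs D c)"
  shows "chromatic_colouring D K c"
  unfolding chromatic_colouring_def
proof (intro conjI allI impI notI)
  fix p assume "directed_cycle D p" and mono: "monochromatic c p"
  then obtain u where p: "pcas u p u" "p \<noteq> []" "set p \<subseteq> parcs D"
    by (auto simp: directed_cycle_def pre_digraph.cycle_def pre_digraph.awalk_def cas_with_proj_eq)
  then have "set p \<subseteq> monochromatic_arcs D c"
    using mono by (simp add: monochromatic_iff_subset_monochromatic_arcs)
  then have "(u, u) \<in> (monochromatic_arcs D c)\<^sup>+"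
    using pcas_imp_trancl[OF p(1,2)] by (rule trancl_mono[rotated])
  then show False using acyclic by (simp add: acyclic_def)
qed (fact assms(1))

lemma (in pair_loopfree_digraph) acyclic_if_chromatic_colouring:
  assumes chromatic: "chromatic_colouring G K c"
  shows "acyclic (monochromatic_arcs G c)"
proof (rule acyclicI, intro allI notI)
  fix u assume u: "(u, u) \<in> (monochromatic_arcs G c)\<^sup>+"
  define H where "H = \<lparr>pverts = pverts G, parcs = monochromatic_arcs G c\<rparr>"
  interpret H: pair_loopfree_digraph H
    by unfold_locales
      (auto simp: H_def monochromatic_arcs_def dest: wellformed' no_loops')
  have "\<exists>p. H.awalk u p u \<and> p \<noteq> []"
    using u H.reachable1_awalk by (simp add: H_def)
  then obtain p where p: "H.cycle p"
    using H.closed_w_imp_cycle H.closed_w_def by blast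
  have "subgraph (with_proj H) (with_proj G)"
    using H.wf_digraph_axioms wf_digraph_axioms
    by (intro subgraphI) (auto simp: H_def monochromatic_arcs_def compatible_def)
  then have "directed_cycle G p"
    using p subgraph_cycle H.cycle_digraph_conv by (auto simp: directed_cycle_def)
  moreover have "monochromatic c p"
  proof -
    obtain v where "pcas v p v" "set p \<subseteq> parcs H"
      using p by (auto simp: H.cycle_def H.awalk_def)
    then show ?thesis
      using monochromatic_iff_subset_monochromatic_arcs[of v p v G c]
      by (auto simp: H_def monochromatic_arcs_def)
  qed
  ultimately show False using chromatic by (auto simp: chromatic_colouring_def)
qed

lemma (in pair_loopfree_digraph) chromatically_colourable_mono:
  fixes \<kappa> :: "'k rel" and \<kappa>' :: "'l rel"
  assumes "chromatically_colourable G \<kappa>" and "\<kappa> \<le>o \<kappa>'"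
  shows "chromatically_colourable G \<kappa>'"
proof -
  obtain c where c: "chromatic_colouring G (Field \<kappa>) c"
    using assms(1) by (auto simp: chromatically_colourable_def)
  then have range: "c v \<in> Field \<kappa>" if "v \<in> pverts G" for v
    using that by (auto simp: chromatic_colouring_def)
  obtain g where g: "inj_on g (Field \<kappa>)" "g ` Field \<kappa> \<subseteq> Field \<kappa>'"
    using card_of_mono2[OF assms(2)] by (auto simp: card_of_ordLeq[symmetric])
  have "monochromatic_arcs G (g \<circ> c) \<subseteq> monochromatic_arcs G c"
    using inj_onD[OF g(1)] range wellformed' by (auto simp: monochromatic_arcs_def)
  then have "acyclic (monochromatic_arcs G (g \<circ> c))"
    using acyclic_if_chromatic_colouring[OF c] acyclic_subset by blast
  moreover have "g \<circ> c \<in> pverts G \<rightarrow> Field \<kappa>'" using g(2) range by auto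
  ultimately show ?thesis
    unfolding chromatically_colourable_def by (blast intro: chromatic_colouring_if_acyclic)
qed

lemma (in pair_loopfree_digraph) dichromatic_number_le_iff:
  fixes \<kappa> :: "'k rel"
  assumes "Card_order \<kappa>"
  shows "dichromatic_number G \<le>o \<kappa> \<longleftrightarrow> chromatically_colourable G \<kappa>"
  using dichromatic_number_le[OF assms] chromatically_colourable_mono dichromatic_number_props(2)
  by blast

lemma (in pair_loopfree_digraph) natLeq_less_dichromatic_number:
  assumes "\<And>c :: 'a \<Rightarrow> nat. \<not> acyclic (monochromatic_arcs G c)"
  shows "natLeq <o dichromatic_number G"
proof (rule ccontr)
  assume "\<not> ?thesis"
  then have "dichromatic_number G \<le>o natLeq"
    using not_ordLess_iff_ordLeq natLeq_Well_order dichromatic_number_props(1)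
      card_order_on_well_order_on by blast
  then obtain c :: "'a \<Rightarrow> nat" where "chromatic_colouring G (Field natLeq) c"
    by (auto simp: dichromatic_number_le_iff natLeq_Card_order chromatically_colourable_def)
  then show False using assms acyclic_if_chromatic_colouring by blast
qed

section \<open>Lexicographic digraphs of sequences\<close>

definition seq_lex :: "(nat \<Rightarrow> 'b rel) \<Rightarrow> (nat \<Rightarrow> 'b) rel" where
  "seq_lex R = {(x, y). \<exists>m. (\<forall>i<m. x i = y i) \<and> (x m, y m) \<in> R m}"

text \<open>Vertices are labelled by sequences, not necessarily injectively, so that the vertex type stays free.\<close>

definition seq_lex_digraph :: "(nat \<Rightarrow> 'b rel) \<Rightarrow> ('a \<Rightarrow> nat \<Rightarrow> 'b) \<Rightarrow> 'a pair_pre_digraph" where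
  "seq_lex_digraph R \<phi> = \<lparr>pverts = UNIV, parcs = inv_image (seq_lex R) \<phi>\<rparr>"

lemma irrefl_seq_lex:
  assumes "\<And>m. irrefl (R m)"
  shows "irrefl (seq_lex R)"
  using assms by (auto simp: irrefl_def seq_lex_def)

lemma pair_loopfree_digraph_seq_lex_digraph:
  assumes "\<And>m. irrefl (R m)"
  shows "pair_loopfree_digraph (seq_lex_digraph R \<phi>)"
  using irrefl_seq_lex[of R, OF assms]
  by unfold_locales (auto simp: seq_lex_digraph_def irrefl_def)

lemma colouring_full_on_some_prefix:
  fixes \<phi> :: "'a \<Rightarrow> nat \<Rightarrow> 'b" and c :: "'a \<Rightarrow> nat"
  assumes "surj \<phi>"
  shows "\<exists>m x. \<forall>b. \<exists>v. (\<forall>i<m. \<phi> v i = x i) \<and> \<phi> v m = b \<and> c v = m"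
proof (rule ccontr)
  assume "\<not> ?thesis"
  then have avoid: "\<exists>b. \<forall>v. (\<forall>i<m. \<phi> v i = x i) \<and> \<phi> v m = b \<longrightarrow> c v \<noteq> m" for m x
    by blast
  have "\<exists>x. \<forall>m. \<forall>v. (\<forall>i<m. \<phi> v i = x i) \<and> \<phi> v m = x m \<longrightarrow> c v \<noteq> m"
    by (rule dependent_wellorder_choice) (simp, rule avoid)
  then obtain x where x: "\<And>m v. (\<forall>i<m. \<phi> v i = x i) \<and> \<phi> v m = x m \<Longrightarrow> c v \<noteq> m"
    by blast
  obtain v where "x = \<phi> v" using assms by (rule surjE)
  with x[of "c v" v] show False by simp
qed

lemma natLeq_less_dichromatic_number_seq_lex_digraph:
  fixes \<phi> :: "'a \<Rightarrow> nat \<Rightarrow> 'b"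
  assumes irrefl: "\<And>m. irrefl (R m)" and cyclic: "\<And>m. \<not> acyclic (R m)" and "surj \<phi>"
  shows "natLeq <o dichromatic_number (seq_lex_digraph R \<phi>)"
proof -
  let ?D = "seq_lex_digraph R \<phi>"
  interpret pair_loopfree_digraph ?D
    using irrefl by (rule pair_loopfree_digraph_seq_lex_digraph)
  have "\<not> acyclic (monochromatic_arcs ?D c)" for c :: "'a \<Rightarrow> nat"
  proof -
    obtain m x v where v: "\<And>b i. i < m \<Longrightarrow> \<phi> (v b) i = x i" "\<And>b. \<phi> (v b) m = b" "\<And>b. c (v b) = m"
      using colouring_full_on_some_prefix[OF \<open>surj \<phi>\<close>] by metis
    then have copy: "(v a, v b) \<in> monochromatic_arcs ?D c" if "(a, b) \<in> R m" for a b
      using that v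
      by (auto simp: monochromatic_arcs_def seq_lex_digraph_def seq_lex_def intro!: exI[of _ m])
    have "(v a, v b) \<in> (monochromatic_arcs ?D c)\<^sup>+" if "(a, b) \<in> (R m)\<^sup>+" for a b
      using that by induction (auto intro: copy trancl_into_trancl)
    then show ?thesis using cyclic[of m] unfolding acyclic_def by blast
  qed
  then show ?thesis by (rule natLeq_less_dichromatic_number)
qed

definition strong_component :: "'a rel \<Rightarrow> 'a \<Rightarrow> 'a set" where
  "strong_component r u = {v. (u, v) \<in> r\<^sup>+ \<and> (v, u) \<in> r\<^sup>+}"

lemma rtrancl_exit:
  assumes "(u, v) \<in> r\<^sup>*" and "u \<in> S" and "v \<notin> S"
  obtains x y where "(u, x) \<in> r\<^sup>*" "x \<in> S" "(x, y) \<in> r" "y \<notin> S" "(y, v) \<in> r\<^sup>*"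
  using assms that
proof (induction arbitrary: thesis)
  case (step y z)
  then show ?case by (cases "y \<in> S") (blast intro: rtrancl_into_rtrancl)+
qed simp

lemma strong_component_exit:
  assumes a: "a \<in> strong_component r u" "a \<in> S" and b: "b \<in> strong_component r u" "b \<notin> S"
  obtains x y where "x \<in> strong_component r u" "x \<in> S" "(x, y) \<in> r"
    "y \<in> strong_component r u" "y \<notin> S"
proof -
  have "(a, b) \<in> r\<^sup>*"
    using a(1) b(1) by (auto simp: strong_component_def)
  then obtain x y where xy: "(a, x) \<in> r\<^sup>*" "x \<in> S" "(x, y) \<in> r" "y \<notin> S" "(y, b) \<in> r\<^sup>*"
    using a(2) b(2) by (rule rtrancl_exit)
  have "(u, x) \<in> r\<^sup>+" "(y, u) \<in> r\<^sup>+"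
    using a(1) b(1) xy(1,5) by (auto simp: strong_component_def)
  with xy(3) have "x \<in> strong_component r u" "y \<in> strong_component r u"
    by (auto simp: strong_component_def intro: trancl_into_trancl trancl_into_trancl2)
  then show thesis using xy(2-4) that by blast
qed

lemma seq_lex_strong_component_projection:
  assumes sub: "r \<subseteq> inv_image (seq_lex R) \<phi>" and irrefl: "\<And>m. irrefl (R m)"
    and u: "(u, u) \<in> r\<^sup>+"
  shows "\<exists>m. \<forall>a\<in>strong_component r u. \<exists>b\<in>strong_component r u. (\<phi> a m, \<phi> b m) \<in> R m"
proof -
  let ?C = "strong_component r u"
  have uC: "u \<in> ?C" using u by (simp add: strong_component_def)
  obtain z where z: "(u, z) \<in> r" "(z, u) \<in> r\<^sup>*" using tranclD[OF u] by blast
  then have "z \<in> ?C" using u by (auto simp: strong_component_def)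
  moreover have "\<phi> z \<noteq> \<phi> u"
    using z(1) sub irrefl_seq_lex[OF irrefl] by (auto simp: irrefl_def in_inv_image)
  ultimately have "\<exists>m. \<exists>a\<in>?C. \<phi> a m \<noteq> \<phi> u m" by (meson ext)
  then obtain m where m: "\<exists>a\<in>?C. \<phi> a m \<noteq> \<phi> u m"
    and const: "\<And>i a. i < m \<Longrightarrow> a \<in> ?C \<Longrightarrow> \<phi> a i = \<phi> u i"
    using exists_least_iff[of "\<lambda>m. \<exists>a\<in>?C. \<phi> a m \<noteq> \<phi> u m"] by blast
  have arc: "(\<phi> a m, \<phi> b m) \<in> R m"
    if "a \<in> ?C" "b \<in> ?C" "(a, b) \<in> r" "\<phi> a m \<noteq> \<phi> b m" for a b
  proof -
    have "(\<phi> a, \<phi> b) \<in> seq_lex R" using \<open>(a, b) \<in> r\<close> sub by auto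
    then obtain j where j: "\<forall>i<j. \<phi> a i = \<phi> b i" "(\<phi> a j, \<phi> b j) \<in> R j"
      by (auto simp: seq_lex_def)
    have "\<not> m < j" using j(1) that(4) by blast
    moreover have "\<not> j < m"
      using j(2) const[of j a] const[of j b] that(1,2) irrefl[of j] by (auto simp: irrefl_def)
    ultimately show ?thesis using j(2) by (metis nat_neq_iff)
  qed
  have "\<exists>b\<in>?C. (\<phi> a m, \<phi> b m) \<in> R m" if a: "a \<in> ?C" for a
  proof -
    obtain b where b: "b \<in> ?C" "\<phi> b m \<noteq> \<phi> a m" using m uC by metis
    obtain x y where "x \<in> ?C" "\<phi> x m = \<phi> a m" "(x, y) \<in> r" "y \<in> ?C" "\<phi> y m \<noteq> \<phi> a m"
      using strong_component_exit[of a r u "{x. \<phi> x m = \<phi> a m}" b] a b by blast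
    then show ?thesis using arc[of x y] by auto
  qed
  then show ?thesis by blast
qed

section \<open>Lexicographic digraphs of directed cycles\<close>

definition cycle_rel :: "nat \<Rightarrow> nat rel" where
  "cycle_rel n = {(i, Suc i mod n) |i. i < n}"

lemma irrefl_cycle_rel:
  assumes "2 \<le> n"
  shows "irrefl (cycle_rel n)"
proof (rule irreflI)
  fix i
  show "(i, i) \<notin> cycle_rel n"
    using assms by (cases "Suc i = n") (auto simp: cycle_rel_def)
qed

lemma cycle_rel_closed_superset:
  assumes "v \<in> V" and closed: "\<And>v. v \<in> V \<Longrightarrow> \<exists>w\<in>V. (v, w) \<in> cycle_rel n"
  shows "{..<n} \<subseteq> V"
proof
  fix w assume "w \<in> {..<n}"
  have step: "v < n" "Suc v mod n \<in> V" if "v \<in> V" for v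
    using closed[OF that] by (auto simp: cycle_rel_def)
  have "(v + j) mod n \<in> V" for j
  proof (induction j)
    case 0
    then show ?case using step(1)[OF \<open>v \<in> V\<close>] \<open>v \<in> V\<close> by simp
  next
    case (Suc j)
    then show ?case using step(2) by (fastforce simp: mod_Suc_eq)
  qed
  from this[of "n - v + w"] show "w \<in> V"
    using step(1)[OF \<open>v \<in> V\<close>] \<open>w \<in> {..<n}\<close> by simp
qed

lemma not_acyclic_cycle_rel:
  assumes "0 < n"
  shows "\<not> acyclic (cycle_rel n)"
proof -
  have "{..<n} \<subseteq> {v. v < n \<and> (0, v) \<in> (cycle_rel n)\<^sup>*}"
    by (rule cycle_rel_closed_superset[of 0])
      (use assms in \<open>auto simp: cycle_rel_def intro: rtrancl_into_rtrancl\<close>)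
  then have "(0, n - 1) \<in> (cycle_rel n)\<^sup>*" using assms by (auto dest: subsetD[of _ _ "n - 1"])
  moreover have "(n - 1, 0) \<in> cycle_rel n"
    using assms by (auto simp: cycle_rel_def intro!: exI[of _ "n - 1"])
  ultimately show ?thesis by (auto simp: acyclic_def dest: rtrancl_into_trancl1)
qed

lemma strong_component_all_values:
  fixes \<phi> :: "'a \<Rightarrow> nat \<Rightarrow> nat"
  assumes k: "\<And>m. 2 \<le> k m" and sub: "r \<subseteq> inv_image (seq_lex (\<lambda>m. cycle_rel (k m))) \<phi>"
    and u: "(u, u) \<in> r\<^sup>+"
  shows "\<exists>m. {..<k m} \<subseteq> (\<lambda>a. \<phi> a m) ` strong_component r u"
proof -
  obtain m where m: "\<forall>a\<in>strong_component r u. \<exists>b\<in>strong_component r u.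
      (\<phi> a m, \<phi> b m) \<in> cycle_rel (k m)"
    using seq_lex_strong_component_projection[OF sub irrefl_cycle_rel[OF k] u] ..
  have "\<phi> u m \<in> (\<lambda>a. \<phi> a m) ` strong_component r u"
    using u by (auto simp: strong_component_def)
  then have "{..<k m} \<subseteq> (\<lambda>a. \<phi> a m) ` strong_component r u"
    by (rule cycle_rel_closed_superset) (use m in blast)
  then show ?thesis ..
qed

lemma chromatic_colouring_zero_pattern:
  fixes \<phi> :: "'a \<Rightarrow> nat \<Rightarrow> nat"
  assumes k: "\<And>m. 2 \<le> k m" and H: "pair_wf_digraph H" "finite (pverts H)"
    and sub: "parcs H \<subseteq> parcs (seq_lex_digraph (\<lambda>m. cycle_rel (k m)) \<phi>)"
  defines "I \<equiv> {m. k m \<le> card (pverts H)}"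
  shows "chromatic_colouring H (Pow I) (\<lambda>v. {m \<in> I. \<phi> v m = 0})"
proof (rule chromatic_colouring_if_acyclic)
  define c where "c v = {m \<in> I. \<phi> v m = 0}" for v
  define r where "r = monochromatic_arcs H c"
  have r_sub: "r \<subseteq> parcs H" by (auto simp: r_def monochromatic_arcs_def)
  have "acyclic r"
  proof (rule acyclicI, intro allI notI)
    fix u assume u: "(u, u) \<in> r\<^sup>+"
    define C where "C = strong_component r u"
    have "r \<subseteq> inv_image (seq_lex (\<lambda>m. cycle_rel (k m))) \<phi>"
      using r_sub sub by (auto simp: seq_lex_digraph_def)
    from strong_component_all_values[OF k this u]
    obtain m where all_values: "{..<k m} \<subseteq> (\<lambda>a. \<phi> a m) ` C"
      unfolding C_def ..
    have "C \<subseteq> Range (r\<^sup>+)" unfolding C_def strong_component_def by blast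
    also have "\<dots> \<subseteq> pverts H"
      using r_sub pair_wf_digraph.in_arcsD2[OF H(1)] by auto
    finally have "{..<k m} \<subseteq> (\<lambda>a. \<phi> a m) ` pverts H" using all_values by blast
    from surj_card_le[OF H(2) this] have "m \<in> I" by (simp add: I_def)
    have "\<exists>a\<in>C. \<phi> a m = w" if "w < k m" for w
      using subsetD[OF all_values, of w] that by auto
    from this[of 0] this[of 1] k[of m]
    obtain a b where a: "a \<in> C" "\<phi> a m = 0" and b: "b \<in> C" "\<phi> b m = 1"
      by auto
    have "c v = c u" if "v \<in> C" for v
      using that monochromatic_arcs_trancl_eq[of v u H c]
      by (simp add: C_def strong_component_def r_def)
    then have "c a = c b" using a(1) b(1) by simp
    moreover have "m \<in> c a" "m \<notin> c b" using a(2) b(2) \<open>m \<in> I\<close> by (auto simp: c_def)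
    ultimately show False by simp
  qed
  then show "acyclic (monochromatic_arcs H (\<lambda>v. {m \<in> I. \<phi> v m = 0}))"
    by (simp add: r_def c_def[abs_def])
qed auto

lemma dichromatic_number_le_card_of_Pow:
  fixes \<phi> :: "'a \<Rightarrow> nat \<Rightarrow> nat"
  assumes k: "\<And>m. 2 \<le> k m" and H: "pair_wf_digraph H" "finite (pverts H)"
    and sub: "parcs H \<subseteq> parcs (seq_lex_digraph (\<lambda>m. cycle_rel (k m)) \<phi>)"
  shows "dichromatic_number H \<le>o |Pow {m. k m \<le> card (pverts H)}|"
proof (rule pair_wf_digraph.dichromatic_number_le[OF H(1) card_of_Card_order])
  show "chromatically_colourable H |Pow {m. k m \<le> card (pverts H)}|"
    unfolding chromatically_colourable_def Field_card_of
    by (rule exI, rule chromatic_colouring_zero_pattern[OF k H sub])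
qed

lemma card_of_ordLeq_iff_card_le:
  assumes "finite A" "finite B"
  shows "|A| \<le>o |B| \<longleftrightarrow> card A \<le> card B"
  using assms by (simp add: card_of_ordLeq[symmetric] inj_on_iff_card_le)

lemma le_pverts_if_dichromatic_number:
  fixes \<phi> :: "'a \<Rightarrow> nat \<Rightarrow> nat" and n :: nat
  assumes k: "\<And>m. 2 \<le> k m" and large: "\<And>m. n < 2 ^ Suc m \<Longrightarrow> s \<le> k m"
    and sub: "subgraph (with_proj H) (with_proj (seq_lex_digraph (\<lambda>m. cycle_rel (k m)) \<phi>))"
    and dichromatic: "dichromatic_number H =o |{..<n + 2}|"
  shows "|{..<s}| \<le>o |pverts H|"
proof (rule ccontr)
  assume few: "\<not> ?thesis"
  then have "|pverts H| \<le>o |{..<s}|"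
    using ordLeq_total[OF card_of_Well_order card_of_Well_order] by blast
  then have fin: "finite (pverts H)"
    by (rule card_of_ordLeq_finite) simp
  with few have card: "card (pverts H) < s" by (simp add: card_of_ordLeq_iff_card_le)
  let ?I = "{m. k m \<le> card (pverts H)}"
  have "m < floor_log (n + 1)" if "m \<in> ?I" for m
  proof (rule ccontr)
    assume "\<not> ?thesis"
    then have "2 * 2 ^ floor_log (n + 1) \<le> (2 ^ Suc m :: nat)" by simp
    then have "n < 2 ^ Suc m" using floor_log_exp2_gt[of "n + 1"] by linarith
    then show False using large that card by fastforce
  qed
  then have I: "?I \<subseteq> {..<floor_log (n + 1)}" by blast
  then have "finite ?I" "card ?I \<le> floor_log (n + 1)"
    using finite_subset card_mono[OF _ I] by auto
  have "dichromatic_number H \<le>o |Pow ?I|"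
    using sub fin
    by (intro dichromatic_number_le_card_of_Pow[of k _ \<phi>] k)
      (auto simp: subgraph_def wf_digraph_wp_iff)
  then have "|{..<n + 2}| \<le>o |Pow ?I|"
    using dichromatic ordIso_symmetric ordIso_ordLeq_trans by blast
  then have "n + 2 \<le> 2 ^ card ?I"
    using \<open>finite ?I\<close> by (simp add: card_of_ordLeq_iff_card_le card_Pow)
  also have "\<dots> \<le> 2 ^ floor_log (n + 1)"
    using \<open>card ?I \<le> floor_log (n + 1)\<close> by (rule power_increasing) simp
  also have "\<dots> \<le> n + 1" by (rule floor_log_exp2_le) simp
  finally show False by simp
qed

lemma card_of_UNIV_nat_set: "|UNIV :: nat set set| =o ctwo ^c natLeq"
  using card_of_Pow_Func[of "UNIV :: nat set"]
  by (simp add: cexp_def ctwo_def Field_natLeq Field_card_of)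

lemma ex_surj_nat_set_nat_seq: "\<exists>\<phi> :: nat set \<Rightarrow> nat \<Rightarrow> nat. surj \<phi>"
proof -
  let ?graph = "\<lambda>x :: nat \<Rightarrow> nat. range (\<lambda>i. prod_encode (i, x i))"
  have "x i = y i" if "?graph x = ?graph y" for x y i
  proof -
    have "prod_encode (i, x i) \<in> ?graph y" using that by blast
    then show ?thesis by auto
  qed
  then have "inj ?graph" by (intro injI ext)
  then show ?thesis by (blast dest: inj_imp_surj_inv)
qed

theorem theorem1p2:
  fixes f :: "nat \<Rightarrow> nat"
  shows "\<exists>D :: nat set pair_pre_digraph.
    pair_loopfree_digraph D \<and>
    |pverts D| =o ctwo ^c natLeq \<and>
    natLeq <o dichromatic_number D \<and>
    (\<forall>n. \<forall>H :: nat set pair_pre_digraph.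
      subgraph (with_proj H) (with_proj D) \<and> dichromatic_number H =o |{..<n + 2}| \<longrightarrow>
      |{..<f n}| \<le>o |pverts H| )"
proof -
  define k where "k m = max 2 (\<Sum>n<2 ^ Suc m. f n)" for m
  have k: "2 \<le> k m" for m by (simp add: k_def)
  have f_le_k: "f n \<le> k m" if "n < 2 ^ Suc m" for n m
    using that member_le_sum[of n "{..<2 ^ Suc m}" f] by (simp add: k_def)
  let ?R = "\<lambda>m. cycle_rel (k m)"
  have irrefl: "irrefl (?R m)" and cyclic: "\<not> acyclic (?R m)" for m
    using irrefl_cycle_rel not_acyclic_cycle_rel k[of m] by simp_all
  obtain \<phi> :: "nat set \<Rightarrow> nat \<Rightarrow> nat" where "surj \<phi>"
    using ex_surj_nat_set_nat_seq by blast
  show ?thesis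
  proof (intro exI conjI allI impI)
    show "pair_loopfree_digraph (seq_lex_digraph ?R \<phi>)"
      using irrefl by (rule pair_loopfree_digraph_seq_lex_digraph)
    show "|pverts (seq_lex_digraph ?R \<phi>)| =o ctwo ^c natLeq"
      using card_of_UNIV_nat_set by (simp add: seq_lex_digraph_def)
    show "natLeq <o dichromatic_number (seq_lex_digraph ?R \<phi>)"
      using irrefl cyclic \<open>surj \<phi>\<close> by (rule natLeq_less_dichromatic_number_seq_lex_digraph)
    show "|{..<f n}| \<le>o |pverts H|"
      if "subgraph (with_proj H) (with_proj (seq_lex_digraph ?R \<phi>)) \<and>
        dichromatic_number H =o |{..<n + 2}|" for n and H :: "nat set pair_pre_digraph"
      using le_pverts_if_dichromatic_number[of k n "f n" H \<phi>] that k f_le_k by blast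
  qed
qed

end
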